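(* There exist a real number $q>1$ and a sequence of positive integers $(a_k)_{k\in\mathbb N}$ satisfying $a_{k+1}/a_k\ge q$ for all $k\in\mathbb N$ such that, with $S_n=\sum_{k=1}^n\cos(2\pi a_kU)$ and $U$ uniformly distributed on $[0,1]$, the sequence $(S_n/n)_{n\in\mathbb N}$ does not satisfy a large deviation principle with speed $n$. More precisely, for this sequence $(a_k)_{k\in\mathbb N}$ there exists $\bar x_0\in(0,1)$ such that for all $x_0\in(0,\bar x_0)$, $$0<\liminf_{n\to\infty}-\frac1n\log\mathbb P(S_n>nx_0)<\limsup_{n\to\infty}-\frac1n\log\mathbb P(S_n>nx_0)<\infty.$$
   Context: Large deviation principle (LDP): a sequence $(Z_n)_{n\in\mathbb N}$ of real random variables satisfies an LDP with speed $s_n\uparrow\infty$ and rate function $I:\mathbb R\to[0,\infty]$ if $I$ is lower semicontinuous and for every Borel set $A\subset\mathbb R$, $$-\inf_{x\in A^\circ}I(x)\le\liminf_{n\to\infty}\frac1{s_n}\log\mathbb P(Z_n\in A)\le\limsup_{n\to\infty}\frac1{s_n}\log\mathbb P(Z_n\in A)\le-\inf_{x\in\bar A}I(x),$$ where $A^\circ$ and $\bar A$ are the interior and closure of $A$. "Does not satisfy an LDP with speed $n$" means that no such rate function exists for $s_n=n$. *)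

theory Defs
  imports "HOL-Probability.Probability"
begin

text \<open>
  The library logarithm has \<open>ln 0 = 0\<close>; the probabilities below need \<open>log 0 = -\<infinity>\<close>.
\<close>

definition log_ext :: "real \<Rightarrow> ereal" where
  "log_ext p = (if p \<le> 0 then -\<infinity> else ereal (ln p))"

definition lower_semicontinuous :: "('a::topological_space \<Rightarrow> ereal) \<Rightarrow> bool" where
  "lower_semicontinuous f \<longleftrightarrow> (\<forall>x. f x \<le> Liminf (at x) f)"

text \<open>
  The infimum over the empty set is \<open>\<infinity>\<close> in \<^typ>\<open>ereal\<close>, as usual. The indices \<open>n\<close> with
  \<open>s n = 0\<close> are irrelevant, since \<open>s\<close> tends to infinity.
\<close>

definition satisfies_LDP ::
    "'a measure \<Rightarrow> (nat \<Rightarrow> 'a \<Rightarrow> real) \<Rightarrow> (nat \<Rightarrow> real) \<Rightarrow> (real \<Rightarrow> ereal) \<Rightarrow> bool" where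
  "satisfies_LDP M Z s I \<longleftrightarrow>
     (\<forall>n. Z n \<in> borel_measurable M) \<and>
     mono s \<and> filterlim s at_top sequentially \<and>
     (\<forall>x. 0 \<le> I x) \<and> lower_semicontinuous I \<and>
     (\<forall>A \<in> sets borel.
        - (INF x \<in> interior A. I x)
          \<le> liminf (\<lambda>n. ereal (1 / s n) * log_ext (\<P>(\<omega> in M. Z n \<omega> \<in> A))) \<and>
        limsup (\<lambda>n. ereal (1 / s n) * log_ext (\<P>(\<omega> in M. Z n \<omega> \<in> A)))
          \<le> - (INF x \<in> closure A. I x))"

definition uniform_01 :: "'a measure \<Rightarrow> ('a \<Rightarrow> real) \<Rightarrow> bool" where
  "uniform_01 M U \<longleftrightarrow> distributed M lborel U (indicator {0..1})"

definition cos_sum :: "(nat \<Rightarrow> nat) \<Rightarrow> ('a \<Rightarrow> real) \<Rightarrow> nat \<Rightarrow> 'a \<Rightarrow> real" where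
  "cos_sum a U n \<omega> = (\<Sum>k = 1..n. cos (2 * pi * real (a k) * U \<omega>))"

end

theory Submission
  imports Defs
begin

text \<open>
  All frequencies are powers of two. They come in units \<open>(c, m * c)\<close>; every gap is large, except
  that \<open>m = 2\<close> for the units in every other one of the blocks \<open>[k!, (k + 1)!)\<close>. Summands separated
  by large gaps are asymptotically independent, so the log-moment generating function of \<open>S n\<close> is,
  up to a bounded error, a sum over units of \<open>ln (B l)\<close> or \<open>2 * ln (A l)\<close>, where \<open>A\<close> and \<open>B\<close> are
  the moment generating functions of \<open>cos \<theta>\<close> and \<open>cos \<theta> + cos (2 * \<theta>)\<close> for uniform \<open>\<theta>\<close>.
  At the ends of the blocks the normalised function therefore oscillates between \<open>ln (A l)\<close> and
  \<open>ln (B l) / 2\<close>. Since \<open>cos \<theta>\<close> and \<open>cos (2 * \<theta>)\<close> are positively correlated after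
  symmetrisation, \<open>B l > (A l)\<^sup>2\<close> for all \<open>l > 0\<close>. Chernoff's bound along the first kind of blocks
  and Cramer's change of measure along the second turn this into different exponential rates.
\<close>

section \<open>Integrals of rapidly oscillating factors\<close>

lemma cos_diff_le: "\<bar>cos x - cos y\<bar> \<le> \<bar>x - y\<bar>" for x y :: real
proof -
  have "cos x - cos y = 2 * sin ((x + y) / 2) * sin ((y - x) / 2)"
    by (rule cos_diff_cos)
  also have "\<bar>\<dots>\<bar> \<le> 2 * 1 * \<bar>(y - x) / 2\<bar>"
    unfolding abs_mult by (intro mult_mono) (use abs_sin_x_le_abs_x[of "(y - x) / 2"] in auto)
  finally show ?thesis by simp
qed

lemma periodic_add_nat:
  fixes g :: "real \<Rightarrow> real"
  assumes "\<And>x. g (x + 1) = g x"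
  shows "g (x + real j) = g x"
proof (induction j)
  case (Suc j)
  have "g (x + real (Suc j)) = g ((x + real j) + 1)" by (simp add: algebra_simps)
  then show ?case using Suc assms by simp
qed simp

lemma integral_periodic_scaled:
  fixes g :: "real \<Rightarrow> real"
  assumes cont: "continuous_on UNIV g" and per: "\<And>x. g (x + 1) = g x" and N: "N > 0"
  shows "integral {real j / real N..real (Suc j) / real N} (\<lambda>u. g (real N * u)) = integral {0..1} g / real N"
proof -
  have "(g has_integral integral {0..1} g) (cbox 0 1)"
    using cont by (auto intro!: integrable_integral integrable_continuous_real continuous_on_subset[OF cont])
  from has_integral_affinity'[OF this, of "real N" "- real j"] N
  have "((\<lambda>x. g (real N * x - real j)) has_integral integral {0..1} g / real N)
     {real j / real N..real (Suc j) / real N}"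
    by (simp add: field_simps)
  moreover have "g (real N * x - real j) = g (real N * x)" for x
    using periodic_add_nat[where g = g, OF per, of "real N * x - real j" j] by simp
  ultimately show ?thesis by (simp add: integral_unique)
qed

text \<open>
  A factor oscillating with frequency \<open>N\<close> decouples from a weight \<open>w\<close> that varies slowly on the
  scale \<open>1 / N\<close>: on each interval \<open>[j / N, (j + 1) / N]\<close> the weight is constant up to a factor
  \<open>exp (K / N)\<close>.
\<close>

lemma integral_slow_times_fast:
  fixes g w :: "real \<Rightarrow> real"
  assumes g: "continuous_on UNIV g" "\<And>x. g (x + 1) = g x" "\<And>x. g x \<ge> 0"
    and w: "continuous_on UNIV w" "\<And>u v. w u \<le> exp (K * \<bar>u - v\<bar>) * w v" "\<And>u. w u > 0"
    and N: "N > 0" and K: "K \<ge> 0"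
  shows "integral {0..1} (\<lambda>u. w u * g (real N * u)) \<le> exp (K / real N) * integral {0..1} w * integral {0..1} g"
    and "integral {0..1} (\<lambda>u. w u * g (real N * u)) \<ge> exp (- K / real N) * integral {0..1} w * integral {0..1} g"
proof -
  define G where "G = integral {0..1} g"
  define x where "x j = real j / real N" for j
  let ?E = "exp (K / real N)"
  let ?h = "\<lambda>u. w u * g (real N * u)"
  have G0: "G \<ge> 0" unfolding G_def using g by (intro integral_nonneg integrable_continuous_real continuous_on_subset[OF g(1)]) auto
  have x_le: "x j \<le> x (Suc j)" and x0: "0 \<le> x j" for j using N by (auto simp: x_def divide_right_mono)
  have x_diff: "x (Suc j) - x j = 1 / N" for j using N by (simp add: x_def field_simps)
  have contg: "continuous_on A (\<lambda>u. g (real N * u))" for A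
    by (intro continuous_on_compose2[OF g(1)] continuous_intros) auto
  have contw: "continuous_on A w" for A by (rule continuous_on_subset[OF w(1)]) auto
  have conth: "continuous_on A ?h" for A by (intro continuous_intros contg contw)
  note int = integrable_continuous_real
  have osc: "w u \<le> ?E * w v" if "u \<in> {x j..x (Suc j)}" "v \<in> {x j..x (Suc j)}" for u v j
  proof -
    have "\<bar>u - v\<bar> \<le> 1 / N" using that x_diff[of j] by auto
    then have "exp (K * \<bar>u - v\<bar>) \<le> ?E" using mult_left_mono[OF _ K] by fastforce
    then have "exp (K * \<bar>u - v\<bar>) * w v \<le> ?E * w v" using w(3)[of v] by (intro mult_right_mono) auto
    then show ?thesis using w(2)[of u v] by linarith
  qed
  have gj: "integral {x j..x (Suc j)} (\<lambda>u. g (real N * u)) = G / N" for j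
    unfolding x_def G_def by (rule integral_periodic_scaled) (use g N in auto)
  \<comment> \<open>For each fixed \<open>v\<close> the weight is at most \<open>?E * w v\<close> on
    the interval, and the oscillating factor integrates to \<open>G / N\<close>. Integrating over
    \<open>v\<close> then recovers the integral of \<open>w\<close>. In \<open>low\<close> the roles
    of \<open>u\<close> and \<open>v\<close> are exchanged.\<close>
  have up: "integral {x j..x (Suc j)} ?h \<le> ?E * integral {x j..x (Suc j)} w * G" for j
  proof -
    have "integral {x j..x (Suc j)} ?h \<le> ?E * w v * (G / N)" if v: "v \<in> {x j..x (Suc j)}" for v
    proof -
      have "integral {x j..x (Suc j)} ?h \<le> integral {x j..x (Suc j)} (\<lambda>u. ?E * w v * g (real N * u))"
        by (intro integral_le int conth continuous_intros contg mult_right_mono osc[OF _ v] g) auto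
      then show ?thesis using gj[of j] by simp
    qed
    then have "integral {x j..x (Suc j)} (\<lambda>v. integral {x j..x (Suc j)} ?h) \<le> integral {x j..x (Suc j)} (\<lambda>v. ?E * (G / N) * w v)"
      by (intro integral_le int continuous_intros contw) (auto simp: mult_ac)
    then show ?thesis using x_diff[of j] x_le[of j] N by (simp add: field_simps)
  qed
  have low: "integral {x j..x (Suc j)} w * G \<le> ?E * integral {x j..x (Suc j)} ?h" for j
  proof -
    have "w v * (G / N) \<le> ?E * integral {x j..x (Suc j)} ?h" if v: "v \<in> {x j..x (Suc j)}" for v
    proof -
      have "integral {x j..x (Suc j)} (\<lambda>u. w v * g (real N * u)) \<le> integral {x j..x (Suc j)} (\<lambda>u. ?E * ?h u)"
        unfolding mult.assoc[symmetric]
        by (intro integral_le int continuous_intros contg contw mult_right_mono osc[OF v] g) auto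
      then show ?thesis using gj[of j] by simp
    qed
    then have "integral {x j..x (Suc j)} (\<lambda>v. (G / N) * w v) \<le> integral {x j..x (Suc j)} (\<lambda>v. ?E * integral {x j..x (Suc j)} ?h)"
      by (intro integral_le int continuous_intros contw) (auto simp: mult_ac)
    then show ?thesis using x_diff[of j] x_le[of j] N by (simp add: field_simps)
  qed
  have comb: "integral {0..x (Suc j)} f = integral {0..x j} f + integral {x j..x (Suc j)} f"
    if "\<And>A. continuous_on A f" for f :: "real \<Rightarrow> real" and j
    using Henstock_Kurzweil_Integration.integral_combine[OF x0[of j] x_le[of j], of f] int[OF that] by simp
  have "integral {0..x j} ?h \<le> ?E * integral {0..x j} w * G" for j
  proof (induction j)
    case (Suc j)
    then show ?case using up[of j] comb[of w j] comb[of ?h j] contw conth by (simp add: algebra_simps)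
  qed (simp add: x_def)
  from this[of N] show "integral {0..1} ?h \<le> ?E * integral {0..1} w * integral {0..1} g"
    using N by (simp add: x_def G_def)
  have "integral {0..x j} w * G \<le> ?E * integral {0..x j} ?h" for j
  proof (induction j)
    case (Suc j)
    then show ?case using low[of j] comb[of w j] comb[of ?h j] contw conth by (simp add: algebra_simps)
  qed (simp add: x_def)
  from this[of N] show "integral {0..1} ?h \<ge> exp (- K / real N) * integral {0..1} w * integral {0..1} g"
    using N by (simp add: x_def G_def exp_minus field_simps)
qed

text \<open>For a constant weight and \<open>K = 0\<close> the two bounds of
  \<open>integral_slow_times_fast\<close> coincide.\<close>

lemma integral_periodic_dilated:
  fixes g :: "real \<Rightarrow> real"
  assumes g: "continuous_on UNIV g" "\<And>x. g (x + 1) = g x" "\<And>x. g x \<ge> 0" and N: "N > 0"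
  shows "integral {0..1} (\<lambda>u. g (real N * u)) = integral {0..1} g"
  using integral_slow_times_fast[OF g, of "\<lambda>_. 1" 0 N] N by (simp add: continuous_on_const)

text \<open>Serves symmetrisation: the shift by 1/2 flips the sign of
  \<open>cos (2 * pi * u)\<close> and fixes \<open>cos (4 * pi * u)\<close>.\<close>

lemma integral_periodic_half_shift:
  fixes g :: "real \<Rightarrow> real"
  assumes cont: "continuous_on UNIV g" and per: "\<And>x. g (x + 1) = g x"
  shows "integral {0..1} (\<lambda>u. g (u + 1/2)) = integral {0..1} g"
proof -
  have c: "continuous_on A g" for A by (rule continuous_on_subset[OF cont]) auto
  have shift: "integral {a..b} (\<lambda>u. g (u + s)) = integral {a + s..b + s} g" for a b s
    using integral_shift[of a s b g] c by (simp add: o_def)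
  have "integral {0..1} (\<lambda>u. g (u + 1/2)) = integral {1/2..3/2} g" using shift[of 0 1 "1/2"] by simp
  also have "\<dots> = integral {1/2..1} g + integral {1..3/2} g"
    by (rule Henstock_Kurzweil_Integration.integral_combine[symmetric]) (auto intro!: integrable_continuous_real c)
  also have "integral {1..3/2} g = integral {0..1/2} g"
    using shift[of 0 "1/2" 1] per by simp
  also have "integral {1/2..1} g + integral {0..1/2} g = integral {0..1} g"
    using Henstock_Kurzweil_Integration.integral_combine[of 0 "1/2" 1 g] integrable_continuous_real[OF c] by simp
  finally show ?thesis .
qed

section \<open>A single cosine and a pair of cosines\<close>

text \<open>The function \<open>A\<close> of the overview, known as the modified Bessel function
  I_0; \<open>pair_mgf\<close> is \<open>B\<close>.\<close>

definition single_mgf :: "real \<Rightarrow> real" where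
  "single_mgf l = integral {0..1} (\<lambda>u. exp (l * cos (2 * pi * u)))"

definition pair_mgf :: "real \<Rightarrow> real" where
  "pair_mgf l = integral {0..1} (\<lambda>u. exp (l * (cos (2 * pi * u) + cos (4 * pi * u))))"

lemma cos_periodic_1:
  "cos (2 * pi * (u + 1)) = cos (2 * pi * u)" "cos (4 * pi * (u + 1)) = cos (4 * pi * u)"
proof -
  show "cos (2 * pi * (u + 1)) = cos (2 * pi * u)" by (simp add: distrib_left)
  have "4 * pi * (u + 1) = 4 * pi * u + 2 * pi + 2 * pi" by (simp add: algebra_simps)
  then show "cos (4 * pi * (u + 1)) = cos (4 * pi * u)" by (metis cos_periodic)
qed

lemma single_mgf_pos: "single_mgf l > 0"
proof -
  have "integral {0..1} (\<lambda>u::real. 0) < single_mgf l"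
    unfolding single_mgf_def by (intro integral_less_real continuous_intros) auto
  then show ?thesis by simp
qed

lemma pair_mgf_pos: "pair_mgf l > 0"
proof -
  have "integral {0..1} (\<lambda>u::real. 0) < pair_mgf l"
    unfolding pair_mgf_def by (intro integral_less_real continuous_intros) auto
  then show ?thesis by simp
qed

lemma single_mgf_eq_cosh: "single_mgf l = integral {0..1} (\<lambda>u. cosh (l * cos (2 * pi * u)))"
proof -
  have half: "cos (2 * pi * (u + 1/2)) = - cos (2 * pi * u)" for u
    by (simp add: distrib_left)
  have "single_mgf l = integral {0..1} (\<lambda>u. exp (- (l * cos (2 * pi * u))))"
    unfolding single_mgf_def
    using integral_periodic_half_shift[of "\<lambda>u. exp (l * cos (2 * pi * u))"] cos_periodic_1 half
    by (simp add: continuous_intros)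
  then have "2 * single_mgf l = integral {0..1} (\<lambda>u. exp (l * cos (2 * pi * u))) + integral {0..1} (\<lambda>u. exp (- (l * cos (2 * pi * u))))"
    by (simp add: single_mgf_def)
  also have "\<dots> = integral {0..1} (\<lambda>u. exp (l * cos (2 * pi * u)) + exp (- (l * cos (2 * pi * u))))"
    by (intro integral_add[symmetric] integrable_continuous_real continuous_intros)
  also have "\<dots> = integral {0..1} (\<lambda>u. 2 * cosh (l * cos (2 * pi * u)))"
    by (rule integral_cong) (simp add: cosh_field_def)
  finally show ?thesis by simp
qed

text \<open>Only the first cosine changes sign under the half-shift, so averaging turns its factor
  alone into a cosh.\<close>

lemma pair_mgf_eq_cosh:
  "pair_mgf l = integral {0..1} (\<lambda>u. cosh (l * cos (2 * pi * u)) * exp (l * cos (4 * pi * u)))"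
proof -
  have half: "cos (2 * pi * (u + 1/2)) = - cos (2 * pi * u)" "cos (4 * pi * (u + 1/2)) = cos (4 * pi * u)" for u
    by (simp_all add: distrib_left)
  have "pair_mgf l = integral {0..1} (\<lambda>u. exp (l * (- cos (2 * pi * u) + cos (4 * pi * u))))"
    unfolding pair_mgf_def
    using integral_periodic_half_shift[of "\<lambda>u. exp (l * (cos (2 * pi * u) + cos (4 * pi * u)))"]
    by (simp add: half cos_periodic_1 continuous_intros)
  then have "2 * pair_mgf l = integral {0..1} (\<lambda>u. exp (l * (cos (2 * pi * u) + cos (4 * pi * u))))
     + integral {0..1} (\<lambda>u. exp (l * (- cos (2 * pi * u) + cos (4 * pi * u))))"
    by (simp add: pair_mgf_def)
  also have "\<dots> = integral {0..1} (\<lambda>u. exp (l * (cos (2 * pi * u) + cos (4 * pi * u)))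
     + exp (l * (- cos (2 * pi * u) + cos (4 * pi * u))))"
    by (intro integral_add[symmetric] integrable_continuous_real continuous_intros)
  also have "\<dots> = integral {0..1} (\<lambda>u. 2 * (cosh (l * cos (2 * pi * u)) * exp (l * cos (4 * pi * u))))"
  proof (rule integral_cong)
    fix u :: real
    have "exp (l * (x + y)) + exp (l * (- x + y)) = 2 * (cosh (l * x) * exp (l * y))" for x y
      by (simp add: cosh_field_def distrib_left distrib_right right_diff_distrib exp_add[symmetric] del: exp_add)
    then show "exp (l * (cos (2 * pi * u) + cos (4 * pi * u))) + exp (l * (- cos (2 * pi * u) + cos (4 * pi * u)))
      = 2 * (cosh (l * cos (2 * pi * u)) * exp (l * cos (4 * pi * u)))" .
  qed
  finally show ?thesis by simp
qed

lemma single_mgf_dilated: "integral {0..1} (\<lambda>u. exp (l * cos (4 * pi * u))) = single_mgf l"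
  unfolding single_mgf_def
  using integral_periodic_dilated[of "\<lambda>u. exp (l * cos (2 * pi * u))" 2] cos_periodic_1
  by (simp add: continuous_intros mult.assoc)

text \<open>The symmetrised integrand is at least 1 and exceeds 1 at \<open>u = 0\<close>; a
  nonnegative continuous function with integral 0 would vanish everywhere.\<close>

lemma single_mgf_gt_1:
  assumes "l > 0"
  shows "single_mgf l > 1"
proof -
  let ?f = "\<lambda>u. cosh (l * cos (2 * pi * u)) - 1"
  have c: "continuous_on {0..1} ?f" by (intro continuous_intros)
  have "integral {0..1} ?f \<ge> 0"
    by (intro integral_nonneg integrable_continuous_real c) (auto simp: cosh_real_ge_1)
  moreover have "integral {0..1} ?f \<noteq> 0"
  proof
    assume "integral {0..1} ?f = 0"
    then have "\<forall>u\<in>{0..1}. ?f u = 0"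
      by (subst (asm) integral_eq_0_iff) (auto intro!: c simp: cosh_real_ge_1)
    from bspec[OF this, of 0] show False using assms by simp
  qed
  moreover have "integral {0..1} ?f = single_mgf l - 1"
    unfolding single_mgf_eq_cosh
    by (subst integral_diff) (auto intro!: integrable_continuous_real continuous_intros)
  ultimately show ?thesis by linarith
qed

lemma single_mgf_le_exp:
  assumes "l \<ge> 0"
  shows "single_mgf l \<le> exp l"
proof -
  have "l * cos x \<le> l" for x using assms by (simp add: mult_left_le)
  then have "single_mgf l \<le> integral {0..1} (\<lambda>u::real. exp l)"
    unfolding single_mgf_def by (intro integral_le integrable_continuous_real continuous_intros) simp
  then show ?thesis by simp
qed

text \<open>
  After symmetrising \<open>u \<mapsto> u + 1/2\<close>, both factors of the integrand of the pair are strictly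
  increasing functions of \<open>cos (4 * pi * u)\<close>, hence positively correlated.
\<close>

lemma pair_mgf_gt:
  assumes l: "l > 0"
  shows "pair_mgf l > single_mgf l ^ 2"
proof -
  define A where "A = single_mgf l"
  \<comment> \<open>\<open>t\<close> is the point where \<open>exp (l * s)\<close> crosses its mean
    \<open>A\<close>, and \<open>h\<close> writes \<open>cosh (l * cos (2 * pi * u))\<close> as a
    function of \<open>s = cos (4 * pi * u)\<close> by the half-angle formula. Centred at
    \<open>h t\<close> and \<open>A\<close>, both factors change sign exactly at \<open>t\<close>,
    so their product is nonnegative.\<close>
  define t where "t = ln A / l"
  define h where "h s = cosh (l * sqrt ((1 + s) / 2))" for s
  have A: "A > 1" "A \<le> exp l" using single_mgf_gt_1[OF l] single_mgf_le_exp[of l] l by (auto simp: A_def)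
  have t: "0 < t" "t \<le> 1" "exp (l * t) = A"
  proof -
    show "0 < t" using A l by (simp add: t_def)
    have "ln A \<le> l" using A ln_mono[of A "exp l"] by simp
    then show "t \<le> 1" using l by (simp add: t_def)
    show "exp (l * t) = A" using A l by (simp add: t_def)
  qed
  have h_less: "h s < h s'" if "-1 \<le> s" "s < s'" for s s'
    unfolding h_def using that l by (subst cosh_real_nonneg_less_iff) auto
  have h_cos: "h (cos (4 * pi * u)) = cosh (l * cos (2 * pi * u))" for u
  proof -
    have "cos (4 * pi * u) = 2 * cos (2 * pi * u) ^ 2 - 1"
      using cos_double_cos[of "2 * pi * u"] by (simp add: mult.assoc[symmetric])
    then have "h (cos (4 * pi * u)) = cosh \<bar>l * cos (2 * pi * u)\<bar>"
      using l by (simp add: h_def abs_mult)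
    then show ?thesis by simp
  qed
  let ?f = "\<lambda>u. (cosh (l * cos (2 * pi * u)) - h t) * (exp (l * cos (4 * pi * u)) - A)"
  have f_pos: "(h s - h t) * (exp (l * s) - A) > 0" if "-1 \<le> s" "s \<noteq> t" for s
  proof (cases "s < t")
    case True
    then have "exp (l * s) < A" using l t(3) by (metis exp_less_mono mult_less_cancel_left_pos)
    then show ?thesis using h_less[OF that(1) True] by (simp add: mult_neg_neg)
  next
    case False
    then have "t < s" using that by simp
    then have "exp (l * s) > A" using l t(3) by (metis exp_less_mono mult_less_cancel_left_pos)
    then show ?thesis using h_less[OF _ \<open>t < s\<close>] t by simp
  qed
  have f_nonneg: "?f u \<ge> 0" for u
    using f_pos[of "cos (4 * pi * u)"] t(3) by (cases "cos (4 * pi * u) = t") (auto simp: h_cos)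
  have c: "continuous_on {0..1} ?f" by (intro continuous_intros)
  have "integral {0..1} ?f \<ge> 0" by (intro integral_nonneg integrable_continuous_real c f_nonneg)
  moreover have "integral {0..1} ?f \<noteq> 0"
  proof
    assume "integral {0..1} ?f = 0"
    then have "\<forall>u\<in>{0..1}. ?f u = 0"
      by (subst (asm) integral_eq_0_iff) (auto intro!: c f_nonneg)
    \<comment> \<open>At \<open>u = 1/4\<close> the second cosine is -1, which lies below
      \<open>t\<close>, so the product is strictly positive there.\<close>
    from bspec[OF this, of "1/4"] have eq: "?f (1/4) = 0" by simp
    have pos: "?f (1/4) > 0" using f_pos[of "cos (4 * pi * (1/4))"] t(1) unfolding h_cos by simp
    show False using pos eq by (metis order_less_irrefl)
  qed
  moreover have "integral {0..1} ?f = pair_mgf l - A * A"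
  proof -
    \<comment> \<open>The terms with \<open>h t\<close> cancel because the mean of
      \<open>exp (l * cos (4 * pi * u))\<close> is \<open>A\<close>.\<close>
    have "integral {0..1} ?f = integral {0..1} (\<lambda>u.
        (cosh (l * cos (2 * pi * u)) * exp (l * cos (4 * pi * u)) - A * cosh (l * cos (2 * pi * u)))
        - (h t * exp (l * cos (4 * pi * u)) - h t * A))"
      by (simp add: algebra_simps)
    also have "\<dots> = (pair_mgf l - A * A) - (h t * A - h t * A)"
      unfolding pair_mgf_eq_cosh A_def
      by (subst integral_diff integral_mult_right,
          (intro integrable_continuous_real continuous_intros)+)+
         (simp add: single_mgf_dilated single_mgf_eq_cosh[symmetric])
    finally show ?thesis by simp
  qed
  ultimately show ?thesis by (simp add: A_def power2_eq_square)
qed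

section \<open>Derivative of the log-moment generating function of a pair\<close>

lemma cos_integral_0: "integral {0..1} (\<lambda>u. cos (2 * pi * u) + cos (4 * pi * u)) = 0"
proof -
  have "((\<lambda>u. cos (2 * pi * u) + cos (4 * pi * u)) has_integral
     (sin (2 * pi * 1) / (2 * pi) + sin (4 * pi * 1) / (4 * pi)) - (sin (2 * pi * 0) / (2 * pi) + sin (4 * pi * 0) / (4 * pi))) {0..1}"
    by (rule fundamental_theorem_of_calculus)
       (auto intro!: derivative_eq_intros simp: has_real_derivative_iff_has_vector_derivative[symmetric])
  moreover have "sin (4 * pi) = 0" using sin_npi[of 4] by simp
  ultimately show ?thesis by (simp add: integral_unique)
qed

text \<open>The mean of the pair under the tilt by \<open>l\<close>, halved because a unit has two
  summands; it is the derivative of \<open>ln (pair_mgf l) / 2\<close>.\<close>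

definition pair_rate_deriv :: "real \<Rightarrow> real" where
  "pair_rate_deriv l = integral {0..1} (\<lambda>u. (cos (2 * pi * u) + cos (4 * pi * u)) *
     exp (l * (cos (2 * pi * u) + cos (4 * pi * u)))) / pair_mgf l / 2"

lemma pair_mgf_has_derivative:
  "(pair_mgf has_real_derivative integral {0..1} (\<lambda>u. (cos (2 * pi * u) + cos (4 * pi * u)) *
     exp (l * (cos (2 * pi * u) + cos (4 * pi * u))))) (at l)"
proof -
  let ?c = "\<lambda>u. cos (2 * pi * u) + cos (4 * pi * u)"
  have "((\<lambda>l. integral (cbox 0 1) (\<lambda>u. exp (l * ?c u))) has_real_derivative
      integral (cbox 0 1) (\<lambda>u. ?c u * exp (l * ?c u))) (at l within UNIV)"
    by (rule leibniz_rule_field_derivative)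
       (auto intro!: derivative_eq_intros integrable_continuous_real continuous_intros simp: case_prod_beta)
  then show ?thesis by (simp add: pair_mgf_def[abs_def])
qed

lemma continuous_pair_rate_deriv: "continuous_on UNIV pair_rate_deriv"
proof -
  let ?c = "\<lambda>u. cos (2 * pi * u) + cos (4 * pi * u)"
  have "continuous_on UNIV (\<lambda>l. integral (cbox 0 1) (\<lambda>u::real. ?c u * exp (l * ?c u)))"
    by (rule integral_continuous_on_param) (auto intro!: continuous_intros simp: case_prod_beta)
  moreover have "continuous_on UNIV pair_mgf"
    using pair_mgf_has_derivative by (intro DERIV_continuous_on) auto
  moreover have "pair_mgf l \<noteq> 0" for l using pair_mgf_pos[of l] by simp
  ultimately show ?thesis unfolding pair_rate_deriv_def[abs_def]
    by (intro continuous_intros) auto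
qed

lemma pair_rate_has_derivative: "((\<lambda>l. ln (pair_mgf l) / 2) has_real_derivative pair_rate_deriv l) (at l)"
  using pair_mgf_pos[of l] unfolding pair_rate_deriv_def
  by (auto intro!: derivative_eq_intros pair_mgf_has_derivative)

lemma pair_mgf_0 [simp]: "pair_mgf 0 = 1"
  by (simp add: pair_mgf_def)

lemma pair_rate_deriv_0 [simp]: "pair_rate_deriv 0 = 0"
  by (simp add: pair_rate_deriv_def cos_integral_0)

lemma continuous_single_mgf: "continuous_on UNIV single_mgf"
proof -
  have "continuous_on UNIV (\<lambda>l. integral (cbox 0 1) (\<lambda>u::real. exp (l * cos (2 * pi * u))))"
    by (rule integral_continuous_on_param) (auto intro!: continuous_intros simp: case_prod_beta)
  then show ?thesis by (simp add: single_mgf_def[abs_def])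
qed

section \<open>The frequencies and their moment generating functions\<close>

text \<open>The index \<open>i\<close> counts units, not summands. Factorial blocks make the units
  before \<open>fact k\<close> a fraction 1/(k + 1) of those before \<open>fact (Suc k)\<close>, so
  the last block decides the average. Unit 0 lies in no block.\<close>

definition paired :: "nat \<Rightarrow> bool" where
  "paired i \<longleftrightarrow> (\<exists>k. even k \<and> fact k \<le> i \<and> i < fact (Suc k))"

text \<open>Unit \<open>i\<close> consists of the summands \<open>2 * i + 1\<close> and
  \<open>2 * i + 2\<close>, so the ratio after an odd \<open>k\<close> is the one inside unit
  \<open>k div 2\<close>. The ratios \<open>2 ^ k\<close> make the decoupling errors summable. The
  first ratio is \<open>2 ^ 0 = 1\<close>, but \<open>freq 0\<close> enters no sum.\<close>

primrec freq :: "nat \<Rightarrow> nat" where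
  "freq 0 = 1"
| "freq (Suc k) = freq k * (if odd k \<and> paired (k div 2) then 2 else 2 ^ k)"

lemma freq_pos: "freq k > 0"
  by (induction k) auto

lemma freq_Suc_ge: "k \<ge> 1 \<Longrightarrow> 2 * freq k \<le> freq (Suc k)"
  using self_le_power[of "2::nat" k] by auto

abbreviation csum :: "nat \<Rightarrow> real \<Rightarrow> real" where
  "csum \<equiv> cos_sum freq id"

lemma csum_Suc: "csum (Suc n) u = csum n u + cos (2 * pi * real (freq (Suc n)) * u)"
  by (simp add: cos_sum_def)

lemma abs_csum_le: "\<bar>csum n u\<bar> \<le> n"
proof -
  have "\<bar>csum n u\<bar> \<le> (\<Sum>k = 1..n. \<bar>cos (2 * pi * real (freq k) * id u)\<bar>)"
    unfolding cos_sum_def by (rule sum_abs)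
  also have "\<dots> \<le> (\<Sum>k = 1..n. 1)" by (intro sum_mono) simp
  finally show ?thesis by simp
qed

lemma continuous_csum: "continuous_on A (csum n)"
  unfolding cos_sum_def[abs_def] id_apply by (intro continuous_intros)

text \<open>The frequencies at least double from index 1 on, so their sum is at most twice the last
  one.\<close>

lemma csum_lipschitz: "\<bar>csum n u - csum n v\<bar> \<le> 4 * pi * freq n * \<bar>u - v\<bar>"
proof -
  have sum_le: "(\<Sum>k = 1..n. freq k) \<le> 2 * freq n"
  proof (induction n)
    case (Suc n)
    show ?case
    proof (cases n)
      case (Suc k)
      then have "2 * freq n \<le> freq (Suc n)" by (intro freq_Suc_ge) simp
      then show ?thesis using Suc.IH by (simp del: freq.simps)
    qed simp
  qed simp
  have "\<bar>csum n u - csum n v\<bar> \<le> (\<Sum>k = 1..n. \<bar>cos (2 * pi * freq k * u) - cos (2 * pi * freq k * v)\<bar>)"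
    unfolding cos_sum_def sum_subtractf[symmetric] id_apply by (rule sum_abs)
  also have "\<dots> \<le> (\<Sum>k = 1..n. 2 * pi * \<bar>u - v\<bar> * freq k)"
  proof (intro sum_mono)
    fix k
    have "\<bar>2 * pi * freq k * u - 2 * pi * freq k * v\<bar> = 2 * pi * \<bar>u - v\<bar> * freq k"
      by (simp add: right_diff_distrib[symmetric] abs_mult)
    then show "\<bar>cos (2 * pi * freq k * u) - cos (2 * pi * freq k * v)\<bar> \<le> 2 * pi * \<bar>u - v\<bar> * freq k"
      using cos_diff_le[of "2 * pi * freq k * u" "2 * pi * freq k * v"] by simp
  qed
  also have "\<dots> = 2 * pi * \<bar>u - v\<bar> * real (\<Sum>k = 1..n. freq k)"
    by (simp add: sum_distrib_left)
  also have "\<dots> \<le> 2 * pi * \<bar>u - v\<bar> * real (2 * freq n)"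
    by (intro mult_left_mono of_nat_mono sum_le) auto
  finally show ?thesis by (simp add: mult_ac)
qed

section \<open>Decoupling across large gaps\<close>

definition csum_mgf :: "nat \<Rightarrow> real \<Rightarrow> real" where
  "csum_mgf n l = integral {0..1} (\<lambda>u. exp (l * csum n u))"

lemma csum_mgf_pos: "csum_mgf n l > 0"
proof -
  have "integral {0..1} (\<lambda>u::real. 0) < csum_mgf n l"
    unfolding csum_mgf_def by (intro integral_less_real continuous_intros continuous_csum) auto
  then show ?thesis by simp
qed

text \<open>The last hypothesis says that the gap after \<open>n\<close> is the large one,
  \<open>freq (Suc n) = 2 ^ n * freq n\<close>. The weight \<open>exp (l * csum n u)\<close> varies
  at scale \<open>freq n\<close>, so \<open>integral_slow_times_fast\<close> applies with
  \<open>K / N\<close> of order \<open>1 / 2 ^ n\<close>. Leaving \<open>m\<close> free allows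
  appending one cosine or a whole pair.\<close>

lemma csum_mgf_extend:
  fixes g :: "real \<Rightarrow> real"
  assumes g: "continuous_on UNIV g" "\<And>x. g (x + 1) = g x" "\<And>x. g x > 0"
    and m: "\<And>u. exp (l * csum m u) = exp (l * csum n u) * g (real (freq (Suc n)) * u)"
    and "even n \<or> \<not> paired (n div 2)"
  shows "\<bar>ln (csum_mgf m l) - ln (csum_mgf n l) - ln (integral {0..1} g)\<bar> \<le> \<bar>l\<bar> * 4 * pi / 2 ^ n"
proof -
  let ?w = "\<lambda>u. exp (l * csum n u)" and ?N = "freq (Suc n)"
  let ?K = "\<bar>l\<bar> * 4 * pi * freq n"
  have w: "?w u \<le> exp (?K * \<bar>u - v\<bar>) * ?w v" for u v
  proof -
    have "l * (csum n u - csum n v) \<le> \<bar>l\<bar> * \<bar>csum n u - csum n v\<bar>"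
      using abs_mult[of l "csum n u - csum n v"] by linarith
    also have "\<dots> \<le> ?K * \<bar>u - v\<bar>"
      using mult_left_mono[OF csum_lipschitz[of n u v], of "\<bar>l\<bar>"] by (simp add: mult_ac)
    finally have "l * csum n u \<le> ?K * \<bar>u - v\<bar> + l * csum n v" by (simp add: algebra_simps)
    then show ?thesis unfolding exp_add[symmetric] by simp
  qed
  have cw: "continuous_on UNIV ?w" by (intro continuous_intros continuous_csum)
  have G: "integral {0..1} g > 0"
  proof -
    have "integral {0..1} (\<lambda>u::real. 0) < integral {0..1} g"
      by (intro integral_less_real continuous_on_subset[OF g(1)] continuous_intros) (auto simp: g)
    then show ?thesis by simp
  qed
  have E: "csum_mgf m l = integral {0..1} (\<lambda>u. ?w u * g (real ?N * u))"
    by (simp add: csum_mgf_def m)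
  have K: "?K / ?N = \<bar>l\<bar> * 4 * pi / 2 ^ n" using assms(5) freq_pos[of n] by (auto simp: field_simps)
  have K_nonneg: "?K \<ge> 0" by simp
  note step = integral_slow_times_fast[of g ?w ?K ?N, OF g(1,2) less_imp_le[OF g(3)] cw w exp_gt_zero freq_pos K_nonneg]
  have "csum_mgf m l \<le> exp (?K / ?N) * csum_mgf n l * integral {0..1} g"
    using step(1) unfolding E[symmetric] csum_mgf_def[symmetric] .
  then have "ln (csum_mgf m l) \<le> ln (exp (?K / ?N) * csum_mgf n l * integral {0..1} g)"
    using csum_mgf_pos[of m l] by (intro ln_mono) auto
  moreover have "csum_mgf m l \<ge> exp (- (?K / ?N)) * csum_mgf n l * integral {0..1} g"
    using step(2) unfolding E[symmetric] csum_mgf_def[symmetric] minus_divide_left[symmetric] .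
  then have "ln (csum_mgf m l) \<ge> ln (exp (- (?K / ?N)) * csum_mgf n l * integral {0..1} g)"
    using csum_mgf_pos[of n l] G by (intro ln_mono) auto
  ultimately show ?thesis
    using csum_mgf_pos[of n l] G unfolding K by (simp add: ln_mult_pos)
qed

definition unit_log_mgf :: "nat \<Rightarrow> real \<Rightarrow> real" where
  "unit_log_mgf i l = (if paired i then ln (pair_mgf l) else 2 * ln (single_mgf l))"

text \<open>In a paired unit both cosines are functions of \<open>freq (Suc (2 * i)) * u\<close> and
  are appended at once, across the large gap before the unit. Otherwise two single cosines are
  appended, each across a large gap, which doubles the error constant \<open>4 * pi\<close>.\<close>

lemma csum_mgf_unit_step:
  "\<bar>ln (csum_mgf (2 * Suc i) l) - ln (csum_mgf (2 * i) l) - unit_log_mgf i l\<bar> \<le> \<bar>l\<bar> * 8 * pi * (1/2) ^ i"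
proof -
  have pow: "\<bar>l\<bar> * 4 * pi / 2 ^ n \<le> \<bar>l\<bar> * 4 * pi * (1/2) ^ i" if "i \<le> n" for n
  proof -
    have "(1/2::real) ^ n \<le> (1/2) ^ i" using that by (intro power_decreasing) auto
    from mult_left_mono[OF this, of "\<bar>l\<bar> * 4 * pi"]
    have "\<bar>l\<bar> * 4 * pi * (1/2) ^ n \<le> \<bar>l\<bar> * 4 * pi * (1/2) ^ i" by simp
    then show ?thesis by (simp add: power_one_over)
  qed
  show ?thesis
  proof (cases "paired i")
    case True
    let ?g = "\<lambda>u. exp (l * (cos (2 * pi * u) + cos (4 * pi * u)))"
    have "\<bar>ln (csum_mgf (2 * Suc i) l) - ln (csum_mgf (2 * i) l) - ln (integral {0..1} ?g)\<bar> \<le> \<bar>l\<bar> * 4 * pi / 2 ^ (2 * i)"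
    proof (rule csum_mgf_extend)
      show "exp (l * csum (2 * Suc i) u) = exp (l * csum (2 * i) u) * ?g (real (freq (Suc (2 * i))) * u)" for u
        using True by (simp add: csum_Suc exp_add[symmetric] algebra_simps del: exp_add)
    qed (auto intro!: continuous_intros simp: cos_periodic_1)
    then show ?thesis using True pow[of "2 * i"] unfolding pair_mgf_def[symmetric] unit_log_mgf_def by simp
  next
    case False
    let ?g = "\<lambda>u. exp (l * cos (2 * pi * u))"
    have "\<bar>ln (csum_mgf (Suc n) l) - ln (csum_mgf n l) - ln (single_mgf l)\<bar> \<le> \<bar>l\<bar> * 4 * pi / 2 ^ n"
      if "n = 2 * i \<or> n = Suc (2 * i)" for n
      unfolding single_mgf_def
    proof (rule csum_mgf_extend)
      show "exp (l * csum (Suc n) u) = exp (l * csum n u) * ?g (real (freq (Suc n)) * u)" for u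
        by (simp add: csum_Suc exp_add[symmetric] algebra_simps del: exp_add freq.simps)
      show "even n \<or> \<not> paired (n div 2)" using False that by auto
    qed (auto intro!: continuous_intros simp: cos_periodic_1)
    then have step: "\<bar>ln (csum_mgf (Suc n) l) - ln (csum_mgf n l) - ln (single_mgf l)\<bar> \<le> \<bar>l\<bar> * 4 * pi * (1/2) ^ i"
      if "n = 2 * i \<or> n = Suc (2 * i)" for n
      using pow[of n] that by (force intro: order.trans)
    have "2 * Suc i = Suc (Suc (2 * i))" "unit_log_mgf i l = 2 * ln (single_mgf l)"
      using False by (simp_all add: unit_log_mgf_def)
    then show ?thesis using step[of "2 * i"] step[of "Suc (2 * i)"] by simp
  qed
qed

text \<open>The unit steps telescope and their errors form a geometric series. The total error does
  not depend on \<open>m\<close>, hence disappears after division by the number of summands.\<close>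

lemma csum_mgf_approx:
  "\<bar>ln (csum_mgf (2 * m) l) - (\<Sum>i<m. unit_log_mgf i l)\<bar> \<le> 16 * pi * \<bar>l\<bar>"
proof -
  have "\<bar>ln (csum_mgf (2 * m) l) - (\<Sum>i<m. unit_log_mgf i l)\<bar> \<le> (\<Sum>i<m. \<bar>l\<bar> * 8 * pi * (1/2) ^ i)"
  proof (induction m)
    case 0
    show ?case by (simp add: csum_mgf_def cos_sum_def)
  next
    case (Suc m)
    then show ?case using csum_mgf_unit_step[of m l] by simp
  qed
  also have "\<dots> = \<bar>l\<bar> * 8 * pi * (\<Sum>i<m. (1/2) ^ i)" by (simp add: sum_distrib_left)
  also have "(\<Sum>i<m. (1/2::real) ^ i) \<le> 2" by (simp add: sum_gp_strict)
  then have "\<bar>l\<bar> * 8 * pi * (\<Sum>i<m. (1/2) ^ i) \<le> \<bar>l\<bar> * 8 * pi * 2" by (intro mult_left_mono) auto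
  finally show ?thesis by (simp add: mult_ac)
qed

lemma unit_log_mgf_bounds:
  assumes "l > 0"
  shows "2 * ln (single_mgf l) \<le> unit_log_mgf i l" "unit_log_mgf i l \<le> ln (pair_mgf l)"
proof -
  have "2 * ln (single_mgf l) = ln (single_mgf l ^ 2)" using single_mgf_pos[of l] by (simp add: ln_realpow)
  also have "\<dots> \<le> ln (pair_mgf l)" using pair_mgf_gt[OF assms] single_mgf_pos[of l] by (intro ln_mono) auto
  finally show "2 * ln (single_mgf l) \<le> unit_log_mgf i l" "unit_log_mgf i l \<le> ln (pair_mgf l)"
    by (auto simp: unit_log_mgf_def)
qed

lemma csum_mgf_bounds:
  assumes "l > 0"
  shows "ln (csum_mgf (2 * m) l) \<le> m * ln (pair_mgf l) + 16 * pi * l"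
    and "ln (csum_mgf (2 * m) l) \<ge> m * (2 * ln (single_mgf l)) - 16 * pi * l"
proof -
  have "(\<Sum>i<m. unit_log_mgf i l) \<le> (\<Sum>i<m. ln (pair_mgf l))"
    "(\<Sum>i<m. 2 * ln (single_mgf l)) \<le> (\<Sum>i<m. unit_log_mgf i l)"
    by (intro sum_mono unit_log_mgf_bounds assms)+
  with csum_mgf_approx[of m l] assms
  show "ln (csum_mgf (2 * m) l) \<le> m * ln (pair_mgf l) + 16 * pi * l"
    "ln (csum_mgf (2 * m) l) \<ge> m * (2 * ln (single_mgf l)) - 16 * pi * l"
    by (simp_all add: mult_ac)
qed

section \<open>Asymptotics along the factorial blocks\<close>

lemma paired_iff:
  assumes "fact k \<le> i" "i < fact (Suc k)"
  shows "paired i \<longleftrightarrow> even k"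
proof
  assume "paired i"
  then obtain k' where k': "even k'" "fact k' \<le> i" "i < fact (Suc k')" by (auto simp: paired_def)
  have "\<not> Suc k \<le> k'" using fact_mono_nat[of "Suc k" k'] assms k' by linarith
  moreover have "\<not> Suc k' \<le> k" using fact_mono_nat[of "Suc k'" k] assms k' by linarith
  ultimately have "k' = k" by simp
  with k' show "even k" by simp
qed (use assms in \<open>auto simp: paired_def\<close>)

text \<open>Every unit of the block starting at \<open>fact k\<close> contributes exactly
  \<open>c l\<close>; only the \<open>fact k\<close> earlier units can deviate, each by at most the
  difference of the two possible values.\<close>

lemma log_mgf_block:
  fixes k :: nat
  defines "c \<equiv> \<lambda>l. if even k then ln (pair_mgf l) else 2 * ln (single_mgf l)"
  shows "\<bar>ln (csum_mgf (2 * fact (Suc k)) l) - fact (Suc k) * c l\<bar>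
    \<le> 16 * pi * \<bar>l\<bar> + fact k * \<bar>ln (pair_mgf l) - 2 * ln (single_mgf l)\<bar>"
proof -
  let ?D = "\<bar>ln (pair_mgf l) - 2 * ln (single_mgf l)\<bar>"
  have "\<bar>(\<Sum>i<fact (Suc k). unit_log_mgf i l - c l)\<bar> \<le> (\<Sum>i<fact (Suc k). \<bar>unit_log_mgf i l - c l\<bar>)"
    by (rule sum_abs)
  also have "\<dots> \<le> (\<Sum>i::nat<fact (Suc k). if i < fact k then ?D else 0)"
    by (intro sum_mono) (auto simp: unit_log_mgf_def c_def paired_iff not_less)
  also have "\<dots> = (\<Sum>i\<in>{..<fact k :: nat}. ?D)"
    using fact_mono_nat[of k "Suc k"] by (intro sum.mono_neutral_cong_right) auto
  finally show ?thesis using csum_mgf_approx[of "fact (Suc k)" l]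
    by (simp add: sum_subtractf del: fact_Suc)
qed

lemma log_mgf_rate_paired:
  "(\<lambda>j. ln (csum_mgf (2 * fact (Suc (2 * j))) l) / real (2 * fact (Suc (2 * j)))) \<longlonglongrightarrow> ln (pair_mgf l) / 2" (is ?P)
  and log_mgf_rate_single:
  "(\<lambda>j. ln (csum_mgf (2 * fact (Suc (Suc (2 * j)))) l) / real (2 * fact (Suc (Suc (2 * j))))) \<longlonglongrightarrow> ln (single_mgf l)" (is ?S)
proof -
  define C where "C = 16 * pi * \<bar>l\<bar> + \<bar>ln (pair_mgf l) - 2 * ln (single_mgf l)\<bar>"
  define c where "c k = (if even k then ln (pair_mgf l) else 2 * ln (single_mgf l))" for k :: nat
  let ?r = "\<lambda>k. ln (csum_mgf (2 * fact (Suc k)) l) / real (2 * fact (Suc k))"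
  have bd: "\<bar>?r k - c k / 2\<bar> \<le> C / real (Suc k)" for k
  proof -
    have "\<bar>ln (csum_mgf (2 * fact (Suc k)) l) - fact (Suc k) * c k\<bar>
       \<le> 16 * pi * \<bar>l\<bar> + fact k * \<bar>ln (pair_mgf l) - 2 * ln (single_mgf l)\<bar>"
      using log_mgf_block[of k l] by (simp add: c_def del: fact_Suc)
    also have "\<dots> \<le> fact k * C"
    proof -
      have "1 * (16 * pi * \<bar>l\<bar>) \<le> fact k * (16 * pi * \<bar>l\<bar>)" by (intro mult_right_mono) auto
      then show ?thesis unfolding C_def distrib_left by simp
    qed
    finally have "\<bar>ln (csum_mgf (2 * fact (Suc k)) l) - fact (Suc k) * c k\<bar> / (2 * fact (Suc k))
       \<le> (fact k * C) / (2 * fact (Suc k))" by (intro divide_right_mono) auto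
    also have "(fact k * C) / (2 * fact (Suc k)) = C / (2 * real (Suc k))"
      by (simp add: divide_simps del: of_nat_Suc)
    also have "\<dots> \<le> C / real (Suc k)" by (intro divide_left_mono) (auto simp: C_def)
    also have "\<bar>ln (csum_mgf (2 * fact (Suc k)) l) - fact (Suc k) * c k\<bar> / (2 * fact (Suc k))
       = \<bar>(ln (csum_mgf (2 * fact (Suc k)) l) - fact (Suc k) * c k) / (2 * fact (Suc k))\<bar>"
      by (simp add: abs_divide del: fact_Suc)
    also have "\<dots> = \<bar>?r k - c k / 2\<bar>" by (simp add: diff_divide_distrib del: fact_Suc)
    finally show ?thesis .
  qed
  have lim: "(\<lambda>k. ?r k - c k / 2) \<longlonglongrightarrow> 0"
    by (rule Lim_null_comparison[OF always_eventually lim_const_over_n[of C, THEN LIMSEQ_Suc]])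
       (use bd in simp)
  have "strict_mono (\<lambda>j::nat. 2 * j)" "strict_mono (\<lambda>j::nat. Suc (2 * j))" by (auto simp: strict_mono_def)
  \<comment> \<open>Even \<open>k = 2 * j\<close> end paired blocks, odd
    \<open>k = 2 * j + 1\<close> end the others.\<close>
  from LIMSEQ_subseq_LIMSEQ[OF lim this(1)] LIMSEQ_subseq_LIMSEQ[OF lim this(2)]
  show ?P ?S unfolding LIM_zero_iff[symmetric, where l = "ln (pair_mgf l) / 2"]
      LIM_zero_iff[symmetric, where l = "ln (single_mgf l)"]
    by (simp_all add: o_def c_def del: fact_Suc)
qed

section \<open>Exponential rates\<close>

context prob_space
begin

lemma integrable_exp_bounded:
  assumes "random_variable borel X" "\<And>\<omega>. \<bar>X \<omega>\<bar> \<le> b"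
  shows "integrable M (\<lambda>\<omega>. exp (l * X \<omega> :: real))"
proof (rule integrable_const_bound[where B = "exp (\<bar>l\<bar> * b)"])
  have "l * X \<omega> \<le> \<bar>l\<bar> * b" for \<omega>
    using mult_left_mono[OF assms(2)[of \<omega>], of "\<bar>l\<bar>"] abs_le_D1[of "l * X \<omega>"] by (simp add: abs_mult)
  then show "AE \<omega> in M. norm (exp (l * X \<omega>)) \<le> exp (\<bar>l\<bar> * b)" by simp
qed (use assms(1) in measurable)

lemma Chernoff_upper:
  assumes "random_variable borel X" "\<And>\<omega>. \<bar>X \<omega>\<bar> \<le> b" "l > 0"
  shows "prob {\<omega> \<in> space M. X \<omega> > c} \<le> exp (- l * c) * expectation (\<lambda>\<omega>. exp (l * X \<omega>))"
proof -
  note int = integrable_exp_bounded[OF assms(1,2), of l]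
  note [measurable] = assms(1)
  have "prob {\<omega> \<in> space M. X \<omega> > c} \<le> prob {\<omega> \<in> space M. c \<le> X \<omega>}"
    by (intro finite_measure_mono) auto
  also have "\<dots> \<le> exp (- l * c) * (LINT \<omega>:space M|M. exp (l * X \<omega>))"
    by (intro Chernoff_ineq_ge assms) (simp_all add: set_integrable_def int cong: Bochner_Integration.integrable_cong)
  finally show ?thesis by (simp add: set_integral_space int)
qed

text \<open>A crude split at \<open>c\<close>. If the moment generating function clearly exceeds
  \<open>exp (l * c)\<close>, the probability decays at most exponentially, which gives finiteness
  of the upper rate.\<close>

lemma mgf_le_prob:
  assumes X: "random_variable borel X" "\<And>\<omega>. \<bar>X \<omega>\<bar> \<le> b" and l: "l \<ge> 0"
  shows "expectation (\<lambda>\<omega>. exp (l * X \<omega>)) \<le> exp (l * c) + exp (l * b) * prob {\<omega> \<in> space M. X \<omega> > c}"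
proof -
  note [measurable] = X(1)
  let ?A = "{\<omega> \<in> space M. X \<omega> > c}"
  have ind: "integrable M (indicator ?A :: 'a \<Rightarrow> real)"
    by (rule integrable_const_bound[where B = 1]) auto
  have "expectation (\<lambda>\<omega>. exp (l * X \<omega>)) \<le> expectation (\<lambda>\<omega>. exp (l * c) + exp (l * b) * indicator ?A \<omega>)"
  proof (rule integral_mono_AE)
    show "AE \<omega> in M. exp (l * X \<omega>) \<le> exp (l * c) + exp (l * b) * indicator ?A \<omega>"
    proof (rule AE_I2)
      fix \<omega> assume "\<omega> \<in> space M"
      moreover have "exp (l * X \<omega>) \<le> exp (l * b)" using X(2)[of \<omega>] l by (simp add: mult_left_mono)
      moreover have "exp (l * X \<omega>) \<le> exp (l * c)" if "X \<omega> \<le> c" using that l by (simp add: mult_left_mono)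
      ultimately show "exp (l * X \<omega>) \<le> exp (l * c) + exp (l * b) * indicator ?A \<omega>"
        by (cases "X \<omega> > c") (auto simp: not_less intro: add_increasing)
    qed
  qed (intro integrable_exp_bounded[OF X] Bochner_Integration.integrable_add integrable_mult_right
      integrable_const ind)+
  also have "\<dots> = exp (l * c) + exp (l * b) * prob ?A"
    using ind by (simp add: prob_space)
  finally show ?thesis .
qed

text \<open>The integrand is split according to \<open>X \<le> c\<close>, \<open>X \<ge> d\<close>
  and the range between. The first two terms are Chernoff bounds for the measure tilted by
  \<open>l\<close>, with additional tilts \<open>- m\<close> and \<open>m\<close>; in the middle
  \<open>exp (l * X \<omega>)\<close> is at most \<open>exp (l * d)\<close>.\<close>

lemma mgf_le_tilted:
  assumes X: "random_variable borel X" "\<And>\<omega>. \<bar>X \<omega>\<bar> \<le> b" and l: "l \<ge> 0" "m \<ge> 0"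
  shows "expectation (\<lambda>\<omega>. exp (l * X \<omega>)) \<le>
     exp (m * c) * expectation (\<lambda>\<omega>. exp ((l - m) * X \<omega>))
     + exp (- (m * d)) * expectation (\<lambda>\<omega>. exp ((l + m) * X \<omega>))
     + exp (l * d) * prob {\<omega> \<in> space M. X \<omega> > c}"
proof -
  note [measurable] = X(1)
  let ?A = "{\<omega> \<in> space M. X \<omega> > c}"
  have ind: "integrable M (indicator ?A :: 'a \<Rightarrow> real)"
    by (rule integrable_const_bound[where B = 1]) auto
  let ?f = "\<lambda>\<omega>. exp (m * c) * exp ((l - m) * X \<omega>) + exp (- (m * d)) * exp ((l + m) * X \<omega>)
     + exp (l * d) * indicator ?A \<omega>"
  note int = integrable_exp_bounded[OF X]
  have "expectation (\<lambda>\<omega>. exp (l * X \<omega>)) \<le> expectation ?f"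
  proof (rule integral_mono_AE)
    show "AE \<omega> in M. exp (l * X \<omega>) \<le> ?f \<omega>"
    proof (rule AE_I2)
      fix \<omega> assume \<omega>: "\<omega> \<in> space M"
      let ?x = "X \<omega>"
      have 1: "exp (l * ?x) \<le> exp (m * c) * exp ((l - m) * ?x)" if "?x \<le> c"
        using mult_left_mono[OF that l(2)] by (simp add: exp_add[symmetric] algebra_simps)
      have 2: "exp (l * ?x) \<le> exp (- (m * d)) * exp ((l + m) * ?x)" if "d \<le> ?x"
        using mult_left_mono[OF that l(2)] by (simp add: exp_add[symmetric] algebra_simps)
      have 3: "exp (l * ?x) \<le> exp (l * d) * indicator ?A \<omega>" if "c < ?x" "?x < d"
        using \<omega> that l by (simp add: mult_left_mono)
      have "exp (m * c) * exp ((l - m) * ?x) \<ge> 0" "exp (- (m * d)) * exp ((l + m) * ?x) \<ge> 0"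
        "exp (l * d) * indicator ?A \<omega> \<ge> (0::real)" by auto
      with 1 2 3 show "exp (l * ?x) \<le> ?f \<omega>" by linarith
    qed
  qed (intro int Bochner_Integration.integrable_add integrable_mult_right ind)+
  also have "\<dots> = exp (m * c) * expectation (\<lambda>\<omega>. exp ((l - m) * X \<omega>))
     + exp (- (m * d)) * expectation (\<lambda>\<omega>. exp ((l + m) * X \<omega>)) + exp (l * d) * prob ?A"
    using int ind by simp
  finally show ?thesis .
qed

end

text \<open>
  Cramer's change of measure, phrased for log-moment generating functions \<open>L j\<close> that satisfy the
  bound of \<open>mgf_le_tilted\<close>: under the tilt by \<open>l\<close>, the mass outside \<open>(x, y)\<close> is exponentially
  small because the derivative of the limit at \<open>l\<close> lies in \<open>(x, y)\<close>.
\<close>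

lemma tilted_lower_bound:
  fixes L :: "nat \<Rightarrow> real \<Rightarrow> real" and N P :: "nat \<Rightarrow> real"
  assumes lim: "\<And>l. (\<lambda>j. L j l / N j) \<longlonglongrightarrow> \<Lambda> l"
    and N: "filterlim N at_top sequentially"
    and tilt: "\<And>j l m. l \<ge> 0 \<Longrightarrow> m \<ge> 0 \<Longrightarrow> exp (L j l) \<le>
      exp (m * (N j * x)) * exp (L j (l - m)) + exp (- (m * (N j * y))) * exp (L j (l + m)) + exp (l * (N j * y)) * P j"
    and deriv: "(\<Lambda> has_real_derivative d) (at l)" and d: "x < d" "d < y" and l: "l > 0" and e: "e > 0"
  shows "eventually (\<lambda>j. P j \<ge> exp (N j * (\<Lambda> l - l * y - e))) sequentially"
proof -
  have "((\<lambda>t. \<Lambda> t - t * y) has_real_derivative d - y) (at l)" "((\<lambda>t. \<Lambda> t - t * x) has_real_derivative d - x) (at l)"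
    by (auto intro!: derivative_eq_intros deriv)
  \<comment> \<open>Moving right from \<open>l\<close> decreases \<open>\<Lambda> t - t * y\<close>,
    moving left decreases \<open>\<Lambda> t - t * x\<close>; a small shift \<open>m\<close> thus
    improves the exponents of both outer terms.\<close>
  from DERIV_neg_dec_right[OF this(1)] DERIV_pos_inc_left[OF this(2)] d
  obtain r1 r2 where r: "r1 > 0" "r2 > 0"
    "\<And>h. 0 < h \<Longrightarrow> h < r1 \<Longrightarrow> \<Lambda> (l + h) - (l + h) * y < \<Lambda> l - l * y"
    "\<And>h. 0 < h \<Longrightarrow> h < r2 \<Longrightarrow> \<Lambda> (l - h) - (l - h) * x < \<Lambda> l - l * x"
    by auto
  define m where "m = min r1 r2 / 2"
  have m: "m > 0" "m < r1" "m < r2" using r by (auto simp: m_def)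
  define a where "a = min (\<Lambda> l - \<Lambda> (l + m) + m * y) (\<Lambda> l - \<Lambda> (l - m) - m * x)"
  have a: "a > 0" using r(3)[OF m(1,2)] r(4)[OF m(1,3)] by (simp add: a_def algebra_simps)
  \<comment> \<open>\<open>a\<close> is the gain in both outer exponents. The tolerance
    \<open>s\<close> leaves them below \<open>\<Lambda> l - 2 * s\<close>, and
    \<open>N j * s \<ge> ln 4\<close> then makes each outer term at most a quarter of
    \<open>Q\<close>, a lower bound for the whole.\<close>
  define s where "s = min (a / 4) (e / 2)"
  have s: "s > 0" "4 * s \<le> a" "2 * s \<le> e" using a e by (auto simp: s_def)
  have close: "eventually (\<lambda>j. \<bar>L j t / N j - \<Lambda> t\<bar> < s) sequentially" for t
    using tendstoD[OF lim s(1), of t] by (simp add: dist_real_def)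
  have "eventually (\<lambda>j. N j \<ge> max 1 (ln 4 / s)) sequentially"
    using N unfolding filterlim_at_top by blast
  then show ?thesis using close[of l] close[of "l - m"] close[of "l + m"]
  proof eventually_elim
    case (elim j)
    have Nj: "N j > 0" "ln 4 \<le> N j * s" using elim(1) s(1) by (auto simp: field_simps)
    have L: "N j * (\<Lambda> l - s) \<le> L j l" "L j (l - m) \<le> N j * (\<Lambda> (l - m) + s)" "L j (l + m) \<le> N j * (\<Lambda> (l + m) + s)"
      using elim(2-4) Nj(1) by (auto simp: abs_less_iff field_simps)
    define Q where "Q = exp (N j * (\<Lambda> l - s))"
    have small: "exp (N j * t) \<le> Q / 4" if "t \<le> \<Lambda> l - 2 * s" for t
    proof -
      have "N j * t \<le> N j * (\<Lambda> l - 2 * s)" using that Nj by (intro mult_left_mono) auto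
      also have "\<dots> \<le> N j * (\<Lambda> l - s) - ln 4" using Nj by (simp add: algebra_simps)
      finally have "exp (N j * t) \<le> exp (N j * (\<Lambda> l - s) - ln 4)" by simp
      then show ?thesis by (simp add: Q_def exp_diff)
    qed
    have "exp (m * (N j * x)) * exp (L j (l - m)) \<le> exp (N j * (\<Lambda> (l - m) + s + m * x))"
      unfolding exp_add[symmetric] using L(2) by (simp add: algebra_simps)
    also have "\<dots> \<le> Q / 4"
      by (rule small) (use s(1,2) in \<open>auto simp: a_def\<close>)
    finally have 1: "exp (m * (N j * x)) * exp (L j (l - m)) \<le> Q / 4" .
    have "exp (- (m * (N j * y))) * exp (L j (l + m)) \<le> exp (N j * (\<Lambda> (l + m) + s - m * y))"
      unfolding exp_add[symmetric] using L(3) by (simp add: algebra_simps)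
    also have "\<dots> \<le> Q / 4"
      by (rule small) (use s(1,2) in \<open>auto simp: a_def\<close>)
    finally have 2: "exp (- (m * (N j * y))) * exp (L j (l + m)) \<le> Q / 4" .
    have "Q \<le> exp (L j l)" using L(1) by (simp add: Q_def)
    with tilt[of l m j] l m(1) 1 2 have "Q / 2 \<le> exp (l * (N j * y)) * P j" by linarith
    moreover have "exp (N j * (\<Lambda> l - e)) \<le> Q / 4" by (rule small) (use s(3) in auto)
    moreover have "Q > 0" by (simp add: Q_def)
    ultimately have "exp (N j * (\<Lambda> l - e)) \<le> exp (l * (N j * y)) * P j" by linarith
    then have "exp (N j * (\<Lambda> l - e)) / exp (l * (N j * y)) \<le> P j" by (simp add: field_simps)
    then show ?case by (simp add: exp_diff[symmetric] algebra_simps)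
  qed
qed

lemma rate_le:
  assumes "n > 0" "p \<ge> exp (- (real n * r))"
  shows "- (ereal (1 / real n) * log_ext p) \<le> ereal r"
proof -
  have p: "p > 0" using assms(2) exp_gt_zero[of "- (real n * r)"] by linarith
  have "- (real n * r) \<le> ln p" using ln_mono[OF assms(2) exp_gt_zero] by simp
  then show ?thesis using p assms(1) by (simp add: log_ext_def field_simps)
qed

lemma rate_ge:
  assumes "n > 0" "p \<le> exp (- (real n * r))"
  shows "- (ereal (1 / real n) * log_ext p) \<ge> ereal r"
proof (cases "p > 0")
  case True
  then have "ln p \<le> - (real n * r)" using ln_mono[OF assms(2) True] by simp
  then show ?thesis using True assms(1) by (simp add: log_ext_def field_simps)
\<comment> \<open>For \<open>p \<le> 0\<close> the extended logarithm is minus infinity and the rate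
  is infinite.\<close>
qed (use assms(1) in \<open>simp add: log_ext_def\<close>)

text \<open>
  Under an LDP with rate function \<open>I\<close>, a gap between the two exponential rates of \<open>(x, \<infinity>)\<close> is a
  jump at \<open>x\<close> of the monotone function \<open>x \<mapsto> INF y>x. I y\<close>, which has only countably many jumps.
\<close>

lemma not_LDP_if_rate_gaps:
  assumes gap: "\<And>x. 0 < x \<Longrightarrow> x < b \<Longrightarrow>
      liminf (\<lambda>n. - (ereal (1 / real n) * log_ext (\<P>(\<omega> in M. S n \<omega> > real n * x))))
      < limsup (\<lambda>n. - (ereal (1 / real n) * log_ext (\<P>(\<omega> in M. S n \<omega> > real n * x))))"
    and b: "b > 0"
  shows "\<not> satisfies_LDP M (\<lambda>n \<omega>. S n \<omega> / real n) (\<lambda>n. real n) I"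
proof
  assume LDP: "satisfies_LDP M (\<lambda>n \<omega>. S n \<omega> / real n) (\<lambda>n. real n) I"
  \<comment> \<open>\<open>G\<close> belongs to the closure and \<open>J\<close> to the interior of
    the half-line, so the LDP places both rates between \<open>G x\<close> and
    \<open>J x\<close>.\<close>
  define G where "G x = (INF y\<in>{x..}. I y)" for x
  define J where "J x = (INF y\<in>{x<..}. I y)" for x
  have jump: "G x < J x" if x: "0 < x" "x < b" for x
  proof -
    let ?f = "\<lambda>n. ereal (1 / real n) * log_ext (\<P>(\<omega> in M. S n \<omega> / real n \<in> {x<..}))"
    let ?g = "\<lambda>n. - (ereal (1 / real n) * log_ext (\<P>(\<omega> in M. S n \<omega> > real n * x)))"
    have "eventually (\<lambda>n. ?g n = - ?f n) sequentially"
      using eventually_gt_at_top[of 0]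
      by eventually_elim (simp add: pos_less_divide_eq mult.commute)
    then have g: "liminf ?g = - limsup ?f" "limsup ?g = - liminf ?f"
      using Liminf_eq[of ?g "\<lambda>n. - ?f n"] Limsup_eq[of ?g "\<lambda>n. - ?f n"]
      by (simp_all only: ereal_Liminf_uminus ereal_Limsup_uminus)
    have "{x<..} \<in> sets borel" by simp
    with LDP have "- (INF y\<in>interior {x<..}. I y) \<le> liminf ?f" "limsup ?f \<le> - (INF y\<in>closure {x<..}. I y)"
      unfolding satisfies_LDP_def by blast+
    then have "- J x \<le> liminf ?f" "limsup ?f \<le> - G x"
      by (simp_all add: J_def G_def interior_open)
    then have "limsup ?g \<le> J x" "- (- limsup ?f) \<le> - G x"
      unfolding g by (simp_all only: ereal_uminus_le_reorder ereal_uminus_uminus)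
    then have "G x \<le> liminf ?g" "limsup ?g \<le> J x"
      unfolding g by (simp_all only: ereal_minus_le_minus)
    then show ?thesis using gap[OF x] by (meson order.strict_trans1 order.strict_trans2)
  qed
  \<comment> \<open>Each jump contains a rational. As \<open>J x \<le> G y\<close> for
    \<open>x < y\<close>, these rationals increase strictly, which embeds an interval into a
    countable set.\<close>
  have "\<exists>q. G x < ereal (real_of_rat q) \<and> ereal (real_of_rat q) < J x" if "0 < x" "x < b" for x
    using ereal_dense3[OF jump[OF that]] .
  then obtain q where q: "\<And>x. 0 < x \<Longrightarrow> x < b \<Longrightarrow> G x < ereal (real_of_rat (q x)) \<and> ereal (real_of_rat (q x)) < J x"
    by metis
  have less: "q x < q y" if "0 < x" "y < b" "x < y" for x y
  proof -
    have "J x \<le> G y" unfolding J_def G_def using that by (intro INF_superset_mono) auto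
    then have "ereal (real_of_rat (q x)) < ereal (real_of_rat (q y))"
      using q[of x] q[of y] that by (meson less_trans order.strict_trans1 order.strict_trans2)
    then show ?thesis by (simp add: of_rat_less)
  qed
  have "inj_on q {0<..<b}"
  proof (rule inj_onI)
    fix x y assume "x \<in> {0<..<b}" "y \<in> {0<..<b}" "q x = q y"
    then show "x = y" using less[of x y] less[of y x] by (cases x y rule: linorder_cases) auto
  qed
  then have "countable {0<..<b}" by (rule countableI')
  then show False using uncountable_open_interval[of 0 b] b by simp
qed

section \<open>Comparison of the rates\<close>

lemma csum_mgf_Suc: "\<bar>ln (csum_mgf (Suc n) l) - ln (csum_mgf n l)\<bar> \<le> \<bar>l\<bar>"
proof -
  have c: "\<bar>l * cos x\<bar> \<le> \<bar>l\<bar>" for x by (simp add: abs_mult mult_left_le)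
  have up: "exp (l * csum (Suc n) u) \<le> exp \<bar>l\<bar> * exp (l * csum n u)" for u
    using c[of "2 * pi * real (freq (Suc n)) * u"]
    unfolding exp_add[symmetric] csum_Suc exp_le_cancel_iff distrib_left by linarith
  have low: "exp (l * csum n u) \<le> exp \<bar>l\<bar> * exp (l * csum (Suc n) u)" for u
    using c[of "2 * pi * real (freq (Suc n)) * u"]
    unfolding exp_add[symmetric] csum_Suc exp_le_cancel_iff distrib_left by linarith
  have "csum_mgf (Suc n) l \<le> integral {0..1} (\<lambda>u. exp \<bar>l\<bar> * exp (l * csum n u))"
    "csum_mgf n l \<le> integral {0..1} (\<lambda>u. exp \<bar>l\<bar> * exp (l * csum (Suc n) u))"
    unfolding csum_mgf_def
    by (intro integral_le integrable_continuous_real continuous_intros continuous_csum up low)+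
  then have "csum_mgf (Suc n) l \<le> exp \<bar>l\<bar> * csum_mgf n l" "csum_mgf n l \<le> exp \<bar>l\<bar> * csum_mgf (Suc n) l"
    by (simp_all add: csum_mgf_def)
  from this[THEN ln_mono] show ?thesis
    using csum_mgf_pos[of n l] csum_mgf_pos[of "Suc n" l] by (simp add: ln_mult_pos)
qed

text \<open>Positivity and finiteness concern all \<open>n\<close>, not just block ends. An odd
  \<open>n\<close> is compared with \<open>n - 1\<close>, at the cost of one extra cosine.\<close>

lemma csum_mgf_growth:
  assumes l: "l > 0"
  shows "ln (csum_mgf n l) \<le> n * (ln (pair_mgf l) / 2) + (16 * pi + 1) * l"
    and "ln (csum_mgf n l) \<ge> n * ln (single_mgf l) - ((16 * pi + 1) * l + ln (single_mgf l))"
proof -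
  have A: "ln (single_mgf l) > 0" using single_mgf_gt_1[OF l] by simp
  have B: "ln (pair_mgf l) > 0" using A unit_log_mgf_bounds[OF l, of 0] by linarith
  obtain m where "n = 2 * m \<or> n = Suc (2 * m)" by (metis evenE oddE Suc_eq_plus1)
  then have "ln (csum_mgf n l) \<le> n * (ln (pair_mgf l) / 2) + (16 * pi + 1) * l \<and>
    ln (csum_mgf n l) \<ge> n * ln (single_mgf l) - ((16 * pi + 1) * l + ln (single_mgf l))"
    using csum_mgf_bounds[OF l, of m] csum_mgf_Suc[of "2 * m" l] A B l
    by (elim disjE) (simp_all add: abs_le_iff algebra_simps)
  then show "ln (csum_mgf n l) \<le> n * (ln (pair_mgf l) / 2) + (16 * pi + 1) * l"
    "ln (csum_mgf n l) \<ge> n * ln (single_mgf l) - ((16 * pi + 1) * l + ln (single_mgf l))" by auto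
qed

text \<open>Mean value theorem on [0,1]: \<open>ln (pair_mgf l)\<close> rises from 0 to a positive
  value.\<close>

lemma pair_rate_deriv_pos: "\<exists>l>0. pair_rate_deriv l > 0"
proof -
  have "\<exists>z>0. z < 1 \<and> ln (pair_mgf 1) / 2 - ln (pair_mgf 0) / 2 = (1 - 0) * pair_rate_deriv z"
    using MVT2[of 0 1 "\<lambda>l. ln (pair_mgf l) / 2" pair_rate_deriv] pair_rate_has_derivative by simp
  moreover have "ln (pair_mgf 1) > 0"
    using single_mgf_gt_1[of 1] unit_log_mgf_bounds[of 1 0] ln_gt_zero[of "single_mgf 1"] by linarith
  ultimately show ?thesis by auto
qed

text \<open>The derivative at 0 vanishes, so the line of slope \<open>x\<close> wins for small
  \<open>l\<close>; this yields a positive Chernoff exponent.\<close>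

lemma pair_rate_small:
  assumes "x > 0"
  shows "\<exists>l>0. ln (pair_mgf l) / 2 < l * x"
proof -
  have "((\<lambda>l. ln (pair_mgf l) / 2 - l * x) has_real_derivative pair_rate_deriv 0 - x) (at 0)"
    by (rule DERIV_diff[OF pair_rate_has_derivative]) (auto intro!: derivative_eq_intros)
  from DERIV_neg_dec_right[OF this] assms obtain r where r: "r > 0"
    "\<And>h. 0 < h \<Longrightarrow> h < r \<Longrightarrow> ln (pair_mgf h) / 2 - h * x < 0"
    by auto
  show ?thesis using r(2)[of "r / 2"] r(1) by (intro exI[of _ "r / 2"]) auto
qed

text \<open>
  At the last \<open>l \<le> l1\<close> where the derivative equals \<open>x\<close> the second inequality reduces to
  \<open>pair_mgf l > (single_mgf l)\<^sup>2\<close>; by continuity it survives slightly to the right, where the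
  derivative exceeds \<open>x\<close>.
\<close>

lemma exists_tilt:
  assumes x: "0 < x" "x < pair_rate_deriv l1" and l1: "l1 > 0"
  obtains l where "l > 0" "pair_rate_deriv l > x"
    "l * (pair_rate_deriv l - x) < ln (pair_mgf l) / 2 - ln (single_mgf l)"
proof -
  let ?h = pair_rate_deriv
  \<comment> \<open>\<open>S\<close> is closed, so its supremum \<open>l0\<close> still satisfies
    \<open>?h l0 \<le> x\<close>, while the derivative exceeds \<open>x\<close> between
    \<open>l0\<close> and \<open>l1\<close>. The point \<open>z\<close> below shows that
    \<open>l0\<close> is positive.\<close>
  define S where "S = {l \<in> {0..l1}. ?h l \<le> x}"
  define l0 where "l0 = Sup S"
  have ch: "isCont ?h l" for l
    using continuous_pair_rate_deriv by (simp add: continuous_on_eq_continuous_at)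
  obtain z where z: "0 \<le> z" "z \<le> l1" "?h z = x"
    using IVT[of ?h 0 x l1] x l1 ch by auto
  then have zS: "z \<in> S" and z0: "z > 0" using x by (auto simp: S_def) (metis less_eq_real_def less_irrefl pair_rate_deriv_0)
  have "closed ({0..l1} \<inter> {l. ?h l \<le> x})"
    by (intro closed_Int closed_Collect_le continuous_pair_rate_deriv) auto
  also have "{0..l1} \<inter> {l. ?h l \<le> x} = S" by (auto simp: S_def)
  finally have "closed S" .
  moreover have bdd: "bdd_above S" by (auto simp: S_def intro!: bdd_aboveI[of _ l1])
  ultimately have "l0 \<in> S" unfolding l0_def using zS by (intro closed_contains_Sup) auto
  then have l0: "l0 \<le> l1" "?h l0 \<le> x" by (auto simp: S_def)
  have "z \<le> l0" unfolding l0_def by (rule cSup_upper[OF zS bdd])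
  then have l0_pos: "l0 > 0" using z0 by simp
  have "l0 < l1" using l0 x by (cases "l0 = l1") auto
  have right: "?h l > x" if "l0 < l" "l < l1" for l
  proof (rule ccontr)
    assume "\<not> ?h l > x"
    then have "l \<in> S" using that l0_pos by (auto simp: S_def)
    then show False using cSup_upper[OF _ bdd, of l] that by (auto simp: l0_def)
  qed
  let ?f = "\<lambda>l. ln (pair_mgf l) / 2 - ln (single_mgf l) - l * (?h l - x)"
  have "ln (pair_mgf l0) > 2 * ln (single_mgf l0)"
  proof -
    have "ln (single_mgf l0 ^ 2) < ln (pair_mgf l0)"
      using pair_mgf_gt[OF l0_pos] single_mgf_pos[of l0] by (intro ln_strict_mono) auto
    then show ?thesis using single_mgf_pos[of l0] by (simp add: ln_realpow)
  qed
  moreover have "l0 * (?h l0 - x) \<le> 0" using l0 l0_pos by (simp add: mult_nonneg_nonpos)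
  ultimately have "?f l0 > 0" by linarith
  moreover have "isCont ?f l0"
  proof -
    have "isCont single_mgf l0"
      using continuous_single_mgf by (simp add: continuous_on_eq_continuous_at)
    moreover have "isCont pair_mgf l0" by (rule DERIV_isCont[OF pair_mgf_has_derivative])
    ultimately show ?thesis
      using single_mgf_pos[of l0] pair_mgf_pos[of l0] ch by (intro continuous_intros) auto
  qed
  then have "(?f \<longlongrightarrow> ?f l0) (at_right l0)"
    by (auto simp: isCont_def intro: filterlim_mono[OF _ order.refl at_le])
  ultimately have "eventually (\<lambda>l. ?f l > 0) (at_right l0)" by (rule order_tendstoD(1)[rotated])
  moreover have "eventually (\<lambda>l. l \<in> {l0<..<l1}) (at_right l0)"
    using \<open>l0 < l1\<close> by (rule eventually_at_right_real)
  ultimately have "\<exists>l. ?f l > 0 \<and> l \<in> {l0<..<l1}"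
    by (intro eventually_happens'[OF _ eventually_conj]) auto
  then obtain l where "?f l > 0" "l \<in> {l0<..<l1}" by blast
  then show thesis using that[of l] right[of l] l0_pos by auto
qed

section \<open>Rates of the lacunary cosine sum\<close>

context prob_space
begin

lemma
  assumes U: "uniform_01 M U"
  shows random_variable_cos_sum: "random_variable borel (cos_sum a U n)"
    and expectation_exp_cos_sum: "expectation (\<lambda>\<omega>. exp (l * cos_sum freq U n \<omega>)) = csum_mgf n l"
proof -
  have D: "distributed M lborel U (\<lambda>x. ennreal (indicator {0..1} x))"
    using U unfolding uniform_01_def by (simp add: ennreal_indicator)
  have [measurable]: "random_variable borel U" using distributed_measurable[OF D] by simp
  show "random_variable borel (cos_sum a U n)" unfolding cos_sum_def[abs_def] by measurable
  have c: "continuous_on A (\<lambda>u. exp (l * csum n u))" for A by (intro continuous_intros continuous_csum)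
  have "csum_mgf n l = (LINT u:{0..1}|lborel. exp (l * csum n u))"
    unfolding csum_mgf_def
    by (intro set_borel_integral_eq_integral(2)[symmetric] borel_integrable_atLeastAtMost' c)
  also have "\<dots> = expectation (\<lambda>\<omega>. exp (l * csum n (U \<omega>)))"
    using distributed_integral[OF D, of "\<lambda>u. exp (l * csum n u)"] c[of UNIV]
    by (simp add: set_lebesgue_integral_def borel_measurable_continuous_onI)
  finally show "expectation (\<lambda>\<omega>. exp (l * cos_sum freq U n \<omega>)) = csum_mgf n l"
    by (simp add: cos_sum_def)
qed

lemma abs_cos_sum_le: "\<bar>cos_sum freq U n \<omega>\<bar> \<le> real n"
  using abs_csum_le[of n "U \<omega>"] by (simp add: cos_sum_def)

lemma cos_sum_prob_le:
  assumes U: "uniform_01 M U" and l: "l > 0"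
  shows "prob {\<omega> \<in> space M. cos_sum freq U n \<omega> > real n * x} \<le> exp (ln (csum_mgf n l) - n * (l * x))"
proof -
  have "prob {\<omega> \<in> space M. cos_sum freq U n \<omega> > real n * x} \<le> exp (- l * (real n * x)) * csum_mgf n l"
    using Chernoff_upper[where c = "real n * x", OF random_variable_cos_sum[OF U] abs_cos_sum_le l, of n]
    by (simp add: expectation_exp_cos_sum[OF U])
  also have "\<dots> = exp (ln (csum_mgf n l) - n * (l * x))"
    using csum_mgf_pos[of n l] by (simp add: exp_diff exp_minus field_simps)
  finally show ?thesis .
qed

text \<open>Each bound on \<open>x\<close> has its purpose: \<open>0 < x\<close> gives a positive
  Chernoff exponent, \<open>x < pair_rate_deriv l1\<close> a suitable tilt for the gap, and
  \<open>x < ln (single_mgf 1)\<close> finiteness.\<close>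

lemma cos_sum_rates:
  assumes U: "uniform_01 M U" and x: "0 < x" "x < pair_rate_deriv l1" "x < ln (single_mgf 1)" and l1: "l1 > 0"
  defines "r \<equiv> \<lambda>n. - (ereal (1 / real n) * log_ext (\<P>(\<omega> in M. cos_sum freq U n \<omega> > real n * x)))"
  shows "0 < liminf r" "liminf r < limsup r" "limsup r < \<infinity>"
proof -
  define p where "p n = prob {\<omega> \<in> space M. cos_sum freq U n \<omega> > real n * x}" for n
  have r_def: "r = (\<lambda>n. - (ereal (1 / real n) * log_ext (p n)))" by (simp add: r_def p_def)
  note p_le = cos_sum_prob_le[OF U, of _ _ x, folded p_def]
  have top: "filterlim (\<lambda>n. real n) at_top sequentially" by (rule filterlim_real_sequentially)
  show "0 < liminf r"
  proof -
    obtain l where l: "l > 0" "ln (pair_mgf l) / 2 < l * x" using pair_rate_small[OF x(1)] by blast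
    define c where "c = l * x - ln (pair_mgf l) / 2"
    define C where "C = (16 * pi + 1) * l"
    have c: "c > 0" using l by (simp add: c_def)
    have "eventually (\<lambda>n. real n \<ge> max 1 (2 * C / c)) sequentially"
      using top unfolding filterlim_at_top by blast
    then have "eventually (\<lambda>n. ereal (c / 2) \<le> r n) sequentially"
    proof eventually_elim
      case (elim n)
      have n: "n > 0" "C \<le> n * c / 2" using elim c by (auto simp: field_simps)
      have "n * c = n * (l * x) - n * (ln (pair_mgf l) / 2)" by (simp add: c_def right_diff_distrib)
      then have "ln (csum_mgf n l) - n * (l * x) \<le> - (n * (c / 2))"
        using csum_mgf_growth(1)[OF l(1), of n, folded C_def] n(2) by linarith
      then have "p n \<le> exp (- (n * (c / 2)))"
        using p_le[OF l(1), of n] by (meson exp_le_cancel_iff order.trans)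
      then show ?case unfolding r_def by (rule rate_ge[OF n(1)])
    qed
    then have "ereal (c / 2) \<le> liminf r" by (rule Liminf_bounded)
    moreover have "0 < ereal (c / 2)" using c by simp
    ultimately show ?thesis by (rule less_le_trans[rotated])
  qed
  show "limsup r < \<infinity>"
  proof -
    define A where "A = ln (single_mgf 1)"
    define C where "C = (16 * pi + 1) + A"
    \<comment> \<open>From this threshold on, the moment generating function at 1 is at least
      \<open>2 * exp (n * x)\<close>, and \<open>mgf_le_prob\<close> leaves
      \<open>p n \<ge> exp (- n)\<close>.\<close>
    have "eventually (\<lambda>n. real n \<ge> max 1 ((C + ln 2) / (A - x))) sequentially"
      using top unfolding filterlim_at_top by blast
    then have "eventually (\<lambda>n. r n \<le> ereal 1) sequentially"
    proof eventually_elim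
      case (elim n)
      have n: "n > 0" "C + ln 2 \<le> n * (A - x)" using elim x(3) by (auto simp: A_def field_simps)
      have "n * x + ln 2 \<le> ln (csum_mgf n 1)"
        using csum_mgf_growth(2)[of 1 n] n(2) by (simp add: C_def A_def algebra_simps)
      then have "exp (n * x + ln 2) \<le> csum_mgf n 1"
        using csum_mgf_pos[of n 1] by (metis exp_le_cancel_iff exp_ln)
      also have "\<dots> \<le> exp (n * x) + exp (real n) * p n"
        using mgf_le_prob[where c = "real n * x" and l = 1, OF random_variable_cos_sum[OF U] abs_cos_sum_le, of n]
          expectation_exp_cos_sum[OF U, of 1 n]
        by (simp add: p_def)
      finally have "exp (n * x) \<le> exp (real n) * p n" by (simp add: exp_add)
      moreover have "1 \<le> exp (n * x)" using x by simp
      ultimately have "1 \<le> exp (real n) * p n" by linarith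
      then have "exp (- (real n * 1)) \<le> p n" by (simp add: exp_minus field_simps)
      then show ?case unfolding r_def by (rule rate_le[OF n(1)])
    qed
    then have "limsup r \<le> ereal 1" by (rule Limsup_bounded)
    then show ?thesis by (rule le_less_trans) simp
  qed
  show "liminf r < limsup r"
  proof -
    obtain l where l: "l > 0" "pair_rate_deriv l > x"
      "l * (pair_rate_deriv l - x) < ln (pair_mgf l) / 2 - ln (single_mgf l)"
      using exists_tilt[OF x(1,2) l1] by blast
    define \<Lambda>1 where "\<Lambda>1 = ln (single_mgf l)"
    define \<Lambda>2 where "\<Lambda>2 = ln (pair_mgf l) / 2"
    \<comment> \<open>A quarter of the available gap: one \<open>e\<close> pays for placing
      \<open>y\<close> beyond the tilted mean, one for the lower bound along \<open>s\<close> and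
      one for the upper bound along \<open>t\<close>.\<close>
    define e where "e = (\<Lambda>2 - \<Lambda>1 - l * (pair_rate_deriv l - x)) / 4"
    define y where "y = pair_rate_deriv l + e / l"
    have e: "e > 0" using l by (simp add: e_def \<Lambda>1_def \<Lambda>2_def)
    have y: "pair_rate_deriv l < y" "l * y = l * pair_rate_deriv l + e"
      using e l(1) by (auto simp: y_def algebra_simps)
    have "4 * e = \<Lambda>2 - \<Lambda>1 - (l * pair_rate_deriv l - l * x)"
      by (simp add: e_def right_diff_distrib)
    then have lt: "l * y - \<Lambda>2 + e < l * x - \<Lambda>1 - e"
      using e y(2) by linarith
    define s :: "nat \<Rightarrow> nat" where "s j = 2 * fact (Suc (2 * j))" for j :: nat
    define t :: "nat \<Rightarrow> nat" where "t j = 2 * fact (Suc (Suc (2 * j)))" for j :: nat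
    have mono: "strict_mono s" "strict_mono t"
      unfolding s_def t_def strict_mono_def by (auto simp: fact_less_mono simp del: fact_Suc)
    have pos: "s j > 0" "t j > 0" for j unfolding s_def t_def by (simp_all del: fact_Suc)
    \<comment> \<open>At the ends of the paired blocks, the change of measure bounds the rate above
      by \<open>l * y - \<Lambda>2 + e\<close>.\<close>
    have "eventually (\<lambda>j. p (s j) \<ge> exp (real (s j) * (ln (pair_mgf l) / 2 - l * y - e))) sequentially"
    proof (rule tilted_lower_bound[where L = "\<lambda>j l. ln (csum_mgf (s j) l)" and N = "\<lambda>j. real (s j)"
          and x = x and d = "pair_rate_deriv l"])
      show "(\<lambda>j. ln (csum_mgf (s j) l) / real (s j)) \<longlonglongrightarrow> ln (pair_mgf l) / 2" for l
        unfolding s_def by (rule log_mgf_rate_paired)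
      show "filterlim (\<lambda>j. real (s j)) at_top sequentially"
        using filterlim_compose[OF top filterlim_subseq[OF mono(1)]] .
      show "exp (ln (csum_mgf (s j) l)) \<le> exp (m * (real (s j) * x)) * exp (ln (csum_mgf (s j) (l - m)))
         + exp (- (m * (real (s j) * y))) * exp (ln (csum_mgf (s j) (l + m))) + exp (l * (real (s j) * y)) * p (s j)"
        if "l \<ge> 0" "m \<ge> 0" for j l m
        using mgf_le_tilted[where c = "real (s j) * x" and d = "real (s j) * y",
            OF random_variable_cos_sum[OF U] abs_cos_sum_le that, of "s j"]
        by (simp add: expectation_exp_cos_sum[OF U] csum_mgf_pos p_def)
    qed (use l y e pair_rate_has_derivative in auto)
    then have "eventually (\<lambda>j. (r \<circ> s) j \<le> ereal (l * y - \<Lambda>2 + e)) sequentially"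
    proof eventually_elim
      case (elim j)
      then show ?case unfolding r_def o_def
        by (intro rate_le[OF pos(1)]) (simp add: \<Lambda>2_def algebra_simps)
    qed
    then have "limsup (r \<circ> s) \<le> ereal (l * y - \<Lambda>2 + e)" by (rule Limsup_bounded)
    moreover have "liminf r \<le> liminf (r \<circ> s)" by (rule liminf_subseq_mono[OF mono(1)])
    moreover have "liminf (r \<circ> s) \<le> limsup (r \<circ> s)" by (rule Liminf_le_Limsup) simp
    ultimately have "liminf r \<le> ereal (l * y - \<Lambda>2 + e)" by (meson order.trans)
    also have "\<dots> < ereal (l * x - \<Lambda>1 - e)" using lt by simp
    also have "\<dots> \<le> limsup r"
    proof -
      \<comment> \<open>At the ends of the other blocks, Chernoff with the same \<open>l\<close>
        bounds the rate below by \<open>l * x - \<Lambda>1 - e\<close>.\<close>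
      have "eventually (\<lambda>j. \<bar>ln (csum_mgf (t j) l) / real (t j) - \<Lambda>1\<bar> < e) sequentially"
        using tendstoD[OF log_mgf_rate_single e, of l] by (simp add: dist_real_def t_def \<Lambda>1_def del: fact_Suc)
      then have "eventually (\<lambda>j. ereal (l * x - \<Lambda>1 - e) \<le> (r \<circ> t) j) sequentially"
      proof eventually_elim
        case (elim j)
        then have "ln (csum_mgf (t j) l) \<le> t j * (\<Lambda>1 + e)"
          using pos(2)[of j] by (simp add: abs_less_iff field_simps)
        then have "ln (csum_mgf (t j) l) - t j * (l * x) \<le> - (t j * (l * x - \<Lambda>1 - e))"
          by (simp add: algebra_simps)
        then have "p (t j) \<le> exp (- (t j * (l * x - \<Lambda>1 - e)))"
          using p_le[OF l(1), of "t j"] by (meson exp_le_cancel_iff order.trans)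
        then show ?case unfolding r_def o_def by (rule rate_ge[OF pos(2)])
      qed
      then have "ereal (l * x - \<Lambda>1 - e) \<le> liminf (r \<circ> t)" by (rule Liminf_bounded)
      moreover have "liminf (r \<circ> t) \<le> limsup (r \<circ> t)" by (rule Liminf_le_Limsup) simp
      moreover have "limsup (r \<circ> t) \<le> limsup r" by (rule limsup_subseq_mono[OF mono(2)])
      ultimately show ?thesis by (meson order.trans)
    qed
    finally show ?thesis .
  qed
qed

end

theorem theoremC:
  shows "\<exists>(q::real) (a :: nat \<Rightarrow> nat).
    q > 1 \<and> (\<forall>k\<ge>1. a k > 0) \<and> (\<forall>k\<ge>1. real (a (Suc k)) / real (a k) \<ge> q) \<and>
    (\<forall>(M :: 'a measure) (U :: 'a \<Rightarrow> real). prob_space M \<longrightarrow> uniform_01 M U \<longrightarrow>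
      \<not> (\<exists>I. satisfies_LDP M (\<lambda>n \<omega>. cos_sum a U n \<omega> / real n) (\<lambda>n. real n) I) \<and>
      (\<exists>xbar. 0 < xbar \<and> xbar < 1 \<and>
        (\<forall>x0. 0 < x0 \<and> x0 < xbar \<longrightarrow>
          0 < liminf (\<lambda>n. - (ereal (1 / real n) * log_ext (\<P>(\<omega> in M. cos_sum a U n \<omega> > real n * x0)))) \<and>
          liminf (\<lambda>n. - (ereal (1 / real n) * log_ext (\<P>(\<omega> in M. cos_sum a U n \<omega> > real n * x0))))
            < limsup (\<lambda>n. - (ereal (1 / real n) * log_ext (\<P>(\<omega> in M. cos_sum a U n \<omega> > real n * x0)))) \<and>
          limsup (\<lambda>n. - (ereal (1 / real n) * log_ext (\<P>(\<omega> in M. cos_sum a U n \<omega> > real n * x0)))) < \<infinity>)))"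
proof -
  obtain l1 where l1: "l1 > 0" "pair_rate_deriv l1 > 0" using pair_rate_deriv_pos by blast
  \<comment> \<open>The first two entries are the upper bounds required by
    \<open>cos_sum_rates\<close>; 1/2 ensures \<open>xbar < 1\<close>.\<close>
  define xbar where "xbar = Min {pair_rate_deriv l1, ln (single_mgf 1), 1/2}"
  have xbar: "0 < xbar" "xbar < 1" "xbar \<le> pair_rate_deriv l1" "xbar \<le> ln (single_mgf 1)"
    using l1 single_mgf_gt_1[of 1] by (auto simp: xbar_def)
  have ratio: "real (freq (Suc k)) / real (freq k) \<ge> 2" if "k \<ge> 1" for k
  proof -
    have "real (2 * freq k) \<le> real (freq (Suc k))" using freq_Suc_ge[OF that] by (rule of_nat_mono)
    then show ?thesis using freq_pos[of k] by (simp add: field_simps del: freq.simps)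
  qed
  show ?thesis
  proof (rule exI[of _ 2], rule exI[of _ freq], intro conjI allI impI)
    fix M :: "'a measure" and U :: "'a \<Rightarrow> real"
    assume "prob_space M" and U: "uniform_01 M U"
    then interpret prob_space M by simp
    have rates: "0 < liminf (\<lambda>n. - (ereal (1 / real n) * log_ext (\<P>(\<omega> in M. cos_sum freq U n \<omega> > real n * x0)))) \<and>
          liminf (\<lambda>n. - (ereal (1 / real n) * log_ext (\<P>(\<omega> in M. cos_sum freq U n \<omega> > real n * x0))))
            < limsup (\<lambda>n. - (ereal (1 / real n) * log_ext (\<P>(\<omega> in M. cos_sum freq U n \<omega> > real n * x0)))) \<and>
          limsup (\<lambda>n. - (ereal (1 / real n) * log_ext (\<P>(\<omega> in M. cos_sum freq U n \<omega> > real n * x0)))) < \<infinity>"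
      if "0 < x0" "x0 < xbar" for x0
      using cos_sum_rates[OF U that(1) _ _ l1(1)] that xbar by simp
    then show "\<exists>xbar. 0 < xbar \<and> xbar < 1 \<and>
        (\<forall>x0. 0 < x0 \<and> x0 < xbar \<longrightarrow>
          0 < liminf (\<lambda>n. - (ereal (1 / real n) * log_ext (\<P>(\<omega> in M. cos_sum freq U n \<omega> > real n * x0)))) \<and>
          liminf (\<lambda>n. - (ereal (1 / real n) * log_ext (\<P>(\<omega> in M. cos_sum freq U n \<omega> > real n * x0))))
            < limsup (\<lambda>n. - (ereal (1 / real n) * log_ext (\<P>(\<omega> in M. cos_sum freq U n \<omega> > real n * x0)))) \<and>
          limsup (\<lambda>n. - (ereal (1 / real n) * log_ext (\<P>(\<omega> in M. cos_sum freq U n \<omega> > real n * x0)))) < \<infinity>)"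
      using xbar(1,2) by blast
    show "\<not> (\<exists>I. satisfies_LDP M (\<lambda>n \<omega>. cos_sum freq U n \<omega> / real n) (\<lambda>n. real n) I)"
      using not_LDP_if_rate_gaps[of xbar M "cos_sum freq U"] rates xbar(1) by blast
  qed (use freq_pos ratio in auto)
qed

end
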